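(* Let $X$ be a nonempty, at most countable set, let $\mathcal P_c(X)=\{K\subset X\mid K\text{ finite}\}$ and let $\mu\colon\mathcal P_c(X)\to[0,\infty)$. Define $$\mathcal E_\mu\colon\mathcal F(X)\to[0,\infty],\qquad\mathcal E_\mu(f)=\sum_{K\in\mathcal P_c(X)}\mu(K)\left(\max_{x\in K}f(x)-\min_{x\in K}f(x)\right)^2,$$ where the term for $K=\emptyset$ is read as $0$. Let $G_\mu$ be the graph with vertex set $X$ in which $x\neq y$ are neighbors if and only if there exists $K\in\mathcal P_c(X)$ with $\mu(K)>0$ and $x,y\in K$. (a) $\mathcal E_\mu$ is a nonlinear resistance form if and only if $G_\mu$ is connected. (b) If for each $x\in X$ we have $\sum_{W\in\mathcal P_c(X),\,x\in W}\mu(W)<\infty$, then $\mathcal F_c(X)\subset D(\mathcal E_\mu)=M(\mathcal E_\mu)$.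
   Context: $\mathcal F(X)$ is the real vector space of all functions $f\colon X\to\mathbb R$, equipped with the topology of pointwise convergence, and $\mathcal F_c(X)$ is the subspace of finitely supported functions. A functional $\mathcal E\colon\mathcal F(X)\to[0,\infty]$ is called a nonlinear resistance form if: (1) $\mathcal E$ is convex with $\mathcal E(0)=0$; (2) $\mathcal E$ is lower semicontinuous with respect to pointwise convergence, i.e. $\mathcal E(f)\le\liminf_i\mathcal E(f_i)$ for every net $f_i\to f$ pointwise; (3) $R(x,y)<\infty$ for all $x,y\in X$, where $R(x,y)=\sup\{f(x)-f(y)\mid\mathcal E(f)\le1\}$; (4) all normal contractions operate on $\mathcal E$, i.e. for every $1$-Lipschitz $C\colon\mathbb R\to\mathbb R$ with $C(0)=0$ and all $f,g\in\mathcal F(X)$, $\mathcal E(f+C\circ g)+\mathcal E(f-C\circ g)\le\mathcal E(f+g)+\mathcal E(f-g)$. $D(\mathcal E)=\{f\in\mathcal F(X)\mid\mathcal E(f)<\infty\}$ and $M(\mathcal E)=\{f\in\mathcal F(X)\mid\lim_{\alpha\to0+}\mathcal E(\alpha f)=0\}$. *)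

theory Defs
  imports "HOL-Analysis.Analysis" "Graph_Theory.Digraph_Component"
begin

text \<open>
  The underlying set \<open>X\<close> is a type \<open>'a\<close>, so that \<open>\<F>(X)\<close> is the type \<open>'a \<Rightarrow> real\<close> and
  functionals into \<open>[0, \<infinity>]\<close> are maps into \<open>ennreal\<close> (where \<open>0 * \<infinity> = 0\<close>).
\<close>

definition convex_functional :: "(('a \<Rightarrow> real) \<Rightarrow> ennreal) \<Rightarrow> bool" where
  "convex_functional E \<longleftrightarrow>
     (\<forall>f g. \<forall>t\<in>{0..1}. E (\<lambda>x. t * f x + (1 - t) * g x) \<le> ennreal t * E f + ennreal (1 - t) * E g)"

text \<open>
  A filter \<open>F\<close> on the function space plays the role of a net; the lemma below shows that this
  covers nets over an arbitrary index type, converging along an arbitrary filter.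
\<close>

definition lsc_pointwise :: "(('a \<Rightarrow> real) \<Rightarrow> ennreal) \<Rightarrow> bool" where
  "lsc_pointwise E \<longleftrightarrow>
     (\<forall>F f. (\<forall>x. ((\<lambda>g. g x) \<longlongrightarrow> f x) F) \<longrightarrow> E f \<le> Liminf F E)"

lemma lsc_pointwise_net:
  fixes E :: "('a \<Rightarrow> real) \<Rightarrow> ennreal" and \<phi> :: "'i \<Rightarrow> 'a \<Rightarrow> real" and F :: "'i filter"
  assumes "lsc_pointwise E" and "\<And>x. ((\<lambda>i. \<phi> i x) \<longlongrightarrow> f x) F"
  shows "E f \<le> Liminf F (\<lambda>i. E (\<phi> i))"
proof -
  have "\<forall>x. ((\<lambda>g. g x) \<longlongrightarrow> f x) (filtermap \<phi> F)"
    using assms(2) by (simp add: filterlim_filtermap)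
  then have "E f \<le> Liminf (filtermap \<phi> F) E"
    using assms(1) unfolding lsc_pointwise_def by blast
  then show ?thesis
    by (simp add: le_Liminf_iff eventually_filtermap)
qed

definition resistance :: "(('a \<Rightarrow> real) \<Rightarrow> ennreal) \<Rightarrow> 'a \<Rightarrow> 'a \<Rightarrow> ereal" where
  "resistance E x y = (SUP f\<in>{f. E f \<le> 1}. ereal (f x - f y))"

definition normal_contractions_operate :: "(('a \<Rightarrow> real) \<Rightarrow> ennreal) \<Rightarrow> bool" where
  "normal_contractions_operate E \<longleftrightarrow>
     (\<forall>C::real \<Rightarrow> real. 1-lipschitz_on UNIV C \<and> C 0 = 0 \<longrightarrow>
       (\<forall>f g. E (\<lambda>x. f x + C (g x)) + E (\<lambda>x. f x - C (g x))
              \<le> E (\<lambda>x. f x + g x) + E (\<lambda>x. f x - g x)))"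

definition nonlinear_resistance_form :: "(('a \<Rightarrow> real) \<Rightarrow> ennreal) \<Rightarrow> bool" where
  "nonlinear_resistance_form E \<longleftrightarrow>
     convex_functional E \<and> E (\<lambda>x. 0) = 0 \<and>
     lsc_pointwise E \<and>
     (\<forall>x y. resistance E x y < \<infinity>) \<and>
     normal_contractions_operate E"

definition form_domain :: "(('a \<Rightarrow> real) \<Rightarrow> ennreal) \<Rightarrow> ('a \<Rightarrow> real) set" where
  "form_domain E = {f. E f < \<infinity>}"

definition modular_domain :: "(('a \<Rightarrow> real) \<Rightarrow> ennreal) \<Rightarrow> ('a \<Rightarrow> real) set" where
  "modular_domain E = {f. ((\<lambda>\<alpha>::real. E (\<lambda>x. \<alpha> * f x)) \<longlongrightarrow> 0) (at_right 0)}"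

definition finitely_supported :: "('a \<Rightarrow> real) set" where
  "finitely_supported = {f. finite {x. f x \<noteq> 0}}"

definition oscillation :: "'a set \<Rightarrow> ('a \<Rightarrow> real) \<Rightarrow> real" where
  "oscillation K f = (if K = {} then 0 else Max (f ` K) - Min (f ` K))"

definition hypergraph_energy :: "('a set \<Rightarrow> real) \<Rightarrow> ('a \<Rightarrow> real) \<Rightarrow> ennreal" where
  "hypergraph_energy \<mu> f = (\<Sum>\<^sub>\<infinity>K\<in>{K. finite K}. ennreal (\<mu> K * (oscillation K f)\<^sup>2))"

text \<open>An undirected edge is represented by the two arcs between its end points.\<close>

definition hypergraph_graph :: "('a set \<Rightarrow> real) \<Rightarrow> 'a pair_pre_digraph" where
  "hypergraph_graph \<mu> =
     \<lparr> pverts = UNIV,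
       parcs = {(x, y). x \<noteq> y \<and> (\<exists>K. finite K \<and> \<mu> K > 0 \<and> x \<in> K \<and> y \<in> K)} \<rparr>"

lemma connected_hypergraph_graph_iff:
  "Digraph_Component.connected (with_proj (hypergraph_graph \<mu>)) \<longleftrightarrow>
     (\<forall>x y. (x, y) \<in> (parcs (hypergraph_graph \<mu>))\<^sup>*)"
proof -
  let ?G = "with_proj (hypergraph_graph \<mu>)"
  have verts: "pverts (hypergraph_graph \<mu>) = UNIV"
    by (simp add: hypergraph_graph_def)
  have arcs: "parcs (mk_symmetric ?G) = parcs (hypergraph_graph \<mu>)"
    by (auto simp: mk_symmetric_def hypergraph_graph_def)
  have rt: "rtrancl_on UNIV r = r\<^sup>*" for r :: "('a \<times> 'a) set"
  proof (intro equalityI subrelI)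
    show "(a, b) \<in> r\<^sup>*" if "(a, b) \<in> rtrancl_on UNIV r" for a b
      using that by (rule rtrancl_on_rtranclI)
    show "(a, b) \<in> rtrancl_on UNIV r" if "(a, b) \<in> r\<^sup>*" for a b
      using that by induction (auto intro: rtrancl_on_into_rtrancl_on)
  qed
  show ?thesis
    by (simp add: Digraph_Component.connected_def strongly_connected_def reachable_def verts arcs rt)
qed

end

theory Submission
  imports Defs
begin

text \<open>
  Every axiom except finiteness of the resistance reduces to one hyperedge, because it is inherited
  by sums.  For the contraction property of a single squared oscillation, put \<open>u, v\<close> for the
  oscillations of \<open>f \<plusminus> C \<circ> g\<close> and \<open>p, q\<close> for those of \<open>f \<plusminus> g\<close>.  Evaluating at extremal points gives
  \<open>max u v \<le> max p q\<close> and \<open>u + v \<le> p + q\<close>, whence \<open>u\<^sup>2 + v\<^sup>2 \<le> p\<^sup>2 + q\<^sup>2\<close>.  An edge of the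
  graph bounds the increment of every \<open>f\<close> with \<open>\<E>(f) \<le> 1\<close>, so connectedness makes the resistance
  finite; conversely, multiples of the indicator of a component have energy \<open>0\<close>.  Part (b) rests on
  the homogeneity \<open>\<E>(\<alpha> f) = \<alpha>\<^sup>2 \<E>(f)\<close>.
\<close>

section \<open>Oscillation\<close>

lemma oscillation_empty [simp]: "oscillation {} f = 0"
  by (simp add: oscillation_def)

lemma diff_le_oscillation:
  assumes "finite K" "x \<in> K" "y \<in> K"
  shows "f x - f y \<le> oscillation K f"
proof -
  have "f x \<le> Max (f ` K)" "Min (f ` K) \<le> f y"
    using assms by auto
  moreover have "K \<noteq> {}"
    using assms by auto
  ultimately show ?thesis
    by (simp add: oscillation_def)
qed

lemma oscillation_attained:
  assumes "finite K" "K \<noteq> {}"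
  obtains x y where "x \<in> K" "y \<in> K" "oscillation K f = f x - f y"
proof -
  have "Max (f ` K) \<in> f ` K" "Min (f ` K) \<in> f ` K"
    using assms by (auto intro!: Max_in Min_in)
  then obtain x y where "x \<in> K" "y \<in> K" "Max (f ` K) = f x" "Min (f ` K) = f y"
    by blast
  then show ?thesis
    using that assms(2) by (simp add: oscillation_def)
qed

lemma oscillation_nonneg: "finite K \<Longrightarrow> 0 \<le> oscillation K f"
  using diff_le_oscillation[of K _ _ f] by (cases "K = {}") fastforce+

lemma oscillation_le:
  assumes "finite K" "0 \<le> c" "\<And>x y. x \<in> K \<Longrightarrow> y \<in> K \<Longrightarrow> f x - f y \<le> c"
  shows "oscillation K f \<le> c"
proof (cases "K = {}")
  case False
  then show ?thesis
    using assms(3) oscillation_attained[OF assms(1) False, of f] by metis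
qed (simp add: assms(2))

lemma oscillation_add_le:
  assumes "finite K"
  shows "oscillation K (\<lambda>x. f x + g x) \<le> oscillation K f + oscillation K g"
proof (rule oscillation_le)
  fix x y assume "x \<in> K" "y \<in> K"
  then show "f x + g x - (f y + g y) \<le> oscillation K f + oscillation K g"
    using diff_le_oscillation[of K x y f] diff_le_oscillation[of K x y g] assms by simp
qed (use assms in \<open>auto intro!: add_nonneg_nonneg oscillation_nonneg\<close>)

lemma oscillation_cmult_le:
  assumes "finite K" "0 \<le> c"
  shows "oscillation K (\<lambda>x. c * f x) \<le> c * oscillation K f"
proof (rule oscillation_le)
  fix x y assume "x \<in> K" "y \<in> K"
  then have "c * (f x - f y) \<le> c * oscillation K f"
    using assms by (intro mult_left_mono diff_le_oscillation)
  then show "c * f x - c * f y \<le> c * oscillation K f"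
    by (simp add: algebra_simps)
qed (use assms in \<open>auto intro!: mult_nonneg_nonneg oscillation_nonneg\<close>)

text \<open>The missing inequality is \<open>oscillation_cmult_le\<close> for the function
  \<open>c * f\<close> and the factor \<open>inverse c\<close>.\<close>

lemma oscillation_cmult:
  assumes "finite K" "0 < c"
  shows "oscillation K (\<lambda>x. c * f x) = c * oscillation K f"
proof (rule antisym)
  have "oscillation K (\<lambda>x. inverse c * (c * f x)) \<le> inverse c * oscillation K (\<lambda>x. c * f x)"
    using assms by (intro oscillation_cmult_le) auto
  then show "c * oscillation K f \<le> oscillation K (\<lambda>x. c * f x)"
    using assms(2) by (simp add: field_simps)
qed (use assms in \<open>auto intro!: oscillation_cmult_le\<close>)

text \<open>On a finite set \<open>Max\<close> and \<open>Min\<close> are iterated binary maxima and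
  minima, so pointwise limits pass through them.\<close>

lemma tendsto_oscillation:
  assumes "finite K" "\<And>x. ((\<lambda>g. g x) \<longlongrightarrow> f x) F"
  shows "(oscillation K \<longlongrightarrow> oscillation K f) F"
proof (cases "K = {}")
  case False
  have "((\<lambda>g. Max (g ` K)) \<longlongrightarrow> Max (f ` K)) F"
    using assms(1) False by (induction rule: finite_ne_induct) (auto intro!: tendsto_max assms(2))
  moreover have "((\<lambda>g. Min (g ` K)) \<longlongrightarrow> Min (f ` K)) F"
    using assms(1) False by (induction rule: finite_ne_induct) (auto intro!: tendsto_min assms(2))
  ultimately show ?thesis
    using False by (simp add: oscillation_def[abs_def] tendsto_diff)
qed (simp add: oscillation_def[abs_def])

section \<open>Convexity and normal contractions for one squared oscillation\<close>

lemma square_convex_comb_le: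
  fixes a b t :: real
  assumes "0 \<le> t" "t \<le> 1"
  shows "(t * a + (1 - t) * b)\<^sup>2 \<le> t * a\<^sup>2 + (1 - t) * b\<^sup>2"
proof -
  \<comment> \<open>The gap in the convexity inequality of the square is computed exactly.\<close>
  have "t * a\<^sup>2 + (1 - t) * b\<^sup>2 - (t * a + (1 - t) * b)\<^sup>2 = t * (1 - t) * (a - b)\<^sup>2"
    by (simp add: power2_eq_square algebra_simps)
  also have "\<dots> \<ge> 0"
    using assms by simp
  finally show ?thesis
    by simp
qed

lemma oscillation_square_convex:
  assumes "finite K" "0 \<le> t" "t \<le> 1"
  shows "(oscillation K (\<lambda>x. t * f x + (1 - t) * g x))\<^sup>2
           \<le> t * (oscillation K f)\<^sup>2 + (1 - t) * (oscillation K g)\<^sup>2"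
proof -
  have "oscillation K (\<lambda>x. t * f x + (1 - t) * g x)
          \<le> oscillation K (\<lambda>x. t * f x) + oscillation K (\<lambda>x. (1 - t) * g x)"
    using assms(1) by (rule oscillation_add_le)
  also have "\<dots> \<le> t * oscillation K f + (1 - t) * oscillation K g"
    using assms by (intro add_mono oscillation_cmult_le) auto
  finally have "(oscillation K (\<lambda>x. t * f x + (1 - t) * g x))\<^sup>2
      \<le> (t * oscillation K f + (1 - t) * oscillation K g)\<^sup>2"
    using assms(1) by (intro power_mono oscillation_nonneg)
  also have "\<dots> \<le> t * (oscillation K f)\<^sup>2 + (1 - t) * (oscillation K g)\<^sup>2"
    using assms by (intro square_convex_comb_le)
  finally show ?thesis .
qed

lemma sum_squares_le_of_weak_majorization:
  fixes u v p q :: real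
  assumes "0 \<le> u" "0 \<le> v" "0 \<le> p" "0 \<le> q"
    and "max u v \<le> max p q" "u + v \<le> p + q"
  shows "u\<^sup>2 + v\<^sup>2 \<le> p\<^sup>2 + q\<^sup>2"
proof -
  \<comment> \<open>The case where the larger left entry \<open>u\<close> is dominated by
    \<open>p\<close>; the other cases differ by swapping names within each pair.\<close>
  have *: "u\<^sup>2 + v\<^sup>2 \<le> p\<^sup>2 + q\<^sup>2"
    if "v \<le> u" "u \<le> p" "u + v \<le> p + q" "0 \<le> v" "0 \<le> q" for u v p q :: real
  proof -
    have "v\<^sup>2 - q\<^sup>2 \<le> (p - u) * (p + u)"
    proof (cases "v \<le> q")
      case True
      then have "v\<^sup>2 \<le> q\<^sup>2" "0 \<le> (p - u) * (p + u)"
        using that by (auto intro!: power_mono mult_nonneg_nonneg)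
      then show ?thesis
        by linarith
    next
      case False
      \<comment> \<open>Here \<open>q < v\<close>. The factors compare separately:
        \<open>v - q <= p - u\<close> by the bound on sums, and \<open>v + q <= p + u\<close>
        because \<open>q < v <= u <= p\<close>.\<close>
      then have "(v - q) * (v + q) \<le> (p - u) * (p + u)"
        using that by (intro mult_mono) auto
      then show ?thesis
        by (simp add: power2_eq_square algebra_simps)
    qed
    then show ?thesis
      by (simp add: power2_eq_square algebra_simps)
  qed
  show ?thesis
    using *[of v u p q] *[of v u q p] *[of u v p q] *[of u v q p] assms
    by (cases "u \<le> v"; cases "p \<le> q") (auto simp: max_def)
qed

text \<open>Between two points, \<open>C\<close> of \<open>g\<close> changes by at most the change
  of \<open>g\<close> in absolute value. Hence the increment is bounded by that of
  \<open>f + g\<close> or of \<open>f - g\<close>, depending on the sign of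
  \<open>g x - g y\<close>.\<close>

lemma oscillation_contraction_le_max:
  assumes K: "finite K" and C: "\<And>s t. \<bar>C s - C t\<bar> \<le> \<bar>s - t\<bar>"
  shows "oscillation K (\<lambda>x. f x + C (g x))
           \<le> max (oscillation K (\<lambda>x. f x + g x)) (oscillation K (\<lambda>x. f x - g x))"
proof (rule oscillation_le)
  fix x y assume "x \<in> K" "y \<in> K"
  then show "f x + C (g x) - (f y + C (g y))
      \<le> max (oscillation K (\<lambda>x. f x + g x)) (oscillation K (\<lambda>x. f x - g x))"
    using diff_le_oscillation[OF K, of x y "\<lambda>x. f x + g x"]
      diff_le_oscillation[OF K, of x y "\<lambda>x. f x - g x"] C[of "g x" "g y"]
    by linarith
qed (use K oscillation_nonneg in \<open>auto simp: le_max_iff_disj\<close>)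

text \<open>Bounding the two oscillations separately would only give twice a maximum. Instead the
  values of \<open>C\<close> are regrouped across them: the two maximum points are compared with
  each other, and so are the two minimum points.\<close>

lemma oscillation_contraction_add_le:
  assumes K: "finite K" and C: "\<And>s t. \<bar>C s - C t\<bar> \<le> \<bar>s - t\<bar>"
  shows "oscillation K (\<lambda>x. f x + C (g x)) + oscillation K (\<lambda>x. f x - C (g x))
           \<le> oscillation K (\<lambda>x. f x + g x) + oscillation K (\<lambda>x. f x - g x)"
proof (cases "K = {}")
  case False
  obtain a b where ab: "a \<in> K" "b \<in> K"
      "oscillation K (\<lambda>x. f x + C (g x)) = f a + C (g a) - (f b + C (g b))"
    using oscillation_attained[OF K False] .
  obtain c d where cd: "c \<in> K" "d \<in> K"
      "oscillation K (\<lambda>x. f x - C (g x)) = f c - C (g c) - (f d - C (g d))"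
    using oscillation_attained[OF K False] .
  \<comment> \<open>One maximum point and one minimum point are assigned to \<open>f + g\<close>,
    the other two to \<open>f - g\<close>.\<close>
  have pair: "f a + g a + (f c - g c) - (f x + g x) - (f y - g y)
      \<le> oscillation K (\<lambda>x. f x + g x) + oscillation K (\<lambda>x. f x - g x)"
    if "a \<in> K" "c \<in> K" "x \<in> K" "y \<in> K" for a c x y
    using diff_le_oscillation[OF K that(1,3), of "\<lambda>x. f x + g x"]
      diff_le_oscillation[OF K that(2,4), of "\<lambda>x. f x - g x"]
    by simp
  have "C (g a) - C (g c) \<le> \<bar>g a - g c\<bar>" "C (g d) - C (g b) \<le> \<bar>g d - g b\<bar>"
    using C[of "g a" "g c"] C[of "g d" "g b"] by linarith+
  then show ?thesis
    \<comment> \<open>The four instances are the four sign choices for \<open>g a - g c\<close> and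
      \<open>g d - g b\<close>.\<close>
    using ab cd pair[of a c b d] pair[of a c d b] pair[of c a b d] pair[of c a d b]
    by (simp add: abs_real_def split: if_splits)
qed simp

lemma oscillation_square_contraction:
  assumes K: "finite K" and C: "\<And>s t. \<bar>C s - C t\<bar> \<le> \<bar>s - t\<bar>"
  shows "(oscillation K (\<lambda>x. f x + C (g x)))\<^sup>2 + (oscillation K (\<lambda>x. f x - C (g x)))\<^sup>2
           \<le> (oscillation K (\<lambda>x. f x + g x))\<^sup>2 + (oscillation K (\<lambda>x. f x - g x))\<^sup>2"
proof (rule sum_squares_le_of_weak_majorization)
  have "oscillation K (\<lambda>x. f x - C (g x))
      \<le> max (oscillation K (\<lambda>x. f x + g x)) (oscillation K (\<lambda>x. f x - g x))"
    \<comment> \<open>The function \<open>- C\<close> satisfies the same Lipschitz bound.\<close>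
    using oscillation_contraction_le_max[OF K, of "\<lambda>s. - C s" f g] C
    by (simp add: abs_minus_commute)
  then show "max (oscillation K (\<lambda>x. f x + C (g x))) (oscillation K (\<lambda>x. f x - C (g x)))
      \<le> max (oscillation K (\<lambda>x. f x + g x)) (oscillation K (\<lambda>x. f x - g x))"
    using oscillation_contraction_le_max[OF K C, of f g] by simp
qed (use oscillation_contraction_add_le[OF K C] oscillation_nonneg[OF K] in auto)

section \<open>Infinite sums of extended nonnegative reals\<close>

lemma infsum_cmult_ennreal:
  fixes f :: "'a \<Rightarrow> ennreal"
  shows "(\<Sum>\<^sub>\<infinity>x\<in>A. c * f x) = c * infsum f A"
  by (simp add: nonneg_infsum_complete SUP_mult_left_ennreal sum_distrib_left)

lemma infsum_sum_ennreal:
  fixes f :: "'b \<Rightarrow> 'a \<Rightarrow> ennreal"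
  assumes "finite S"
  shows "(\<Sum>\<^sub>\<infinity>x\<in>A. \<Sum>i\<in>S. f i x) = (\<Sum>i\<in>S. infsum (f i) A)"
  using assms by induction (simp_all add: infsum_add nonneg_summable_on_complete)

text \<open>Fatou's lemma for counting measure, along an arbitrary filter. Any \<open>y\<close>
  below the infinite sum is already below a finite partial sum; finite sums converge, and each
  partial sum is at most the full one.\<close>

lemma infsum_le_Liminf_ennreal:
  fixes \<phi> :: "'b \<Rightarrow> 'a \<Rightarrow> ennreal"
  assumes "\<And>k. k \<in> A \<Longrightarrow> ((\<lambda>i. \<phi> i k) \<longlongrightarrow> h k) F"
  shows "infsum h A \<le> Liminf F (\<lambda>i. infsum (\<phi> i) A)"
  unfolding le_Liminf_iff
proof (intro allI impI)
  fix y assume "y < infsum h A"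
  then obtain S where S: "finite S" "S \<subseteq> A" "y < sum h S"
    by (auto simp: nonneg_infsum_complete less_SUP_iff)
  have "((\<lambda>i. sum (\<phi> i) S) \<longlongrightarrow> sum h S) F"
    using S(2) by (intro tendsto_sum assms) auto
  then have "\<forall>\<^sub>F i in F. y < sum (\<phi> i) S"
    using S(3) by (rule order_tendstoD)
  then show "\<forall>\<^sub>F i in F. y < infsum (\<phi> i) A"
  proof eventually_elim
    case (elim i)
    also have "sum (\<phi> i) S \<le> infsum (\<phi> i) A"
      using S by (auto simp: nonneg_infsum_complete intro!: SUP_upper)
    finally show ?case .
  qed
qed

section \<open>The hypergraph energy\<close>

lemma hypergraph_energy_zero: "hypergraph_energy \<mu> (\<lambda>x. 0) = 0"
  unfolding hypergraph_energy_def oscillation_def by (intro infsum_0) auto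

lemma hypergraph_energy_term_le:
  assumes "finite K"
  shows "ennreal (\<mu> K * (oscillation K f)\<^sup>2) \<le> hypergraph_energy \<mu> f"
proof -
  have "(\<Sum>\<^sub>\<infinity>K\<in>{K}. ennreal (\<mu> K * (oscillation K f)\<^sup>2)) \<le> hypergraph_energy \<mu> f"
    unfolding hypergraph_energy_def using assms
    by (intro infsum_mono_neutral) (auto intro: nonneg_summable_on_complete)
  then show ?thesis
    by simp
qed

lemma hypergraph_energy_cmult:
  assumes "0 < c"
  shows "hypergraph_energy \<mu> (\<lambda>x. c * f x) = ennreal (c\<^sup>2) * hypergraph_energy \<mu> f"
proof -
  have "hypergraph_energy \<mu> (\<lambda>x. c * f x)
      = (\<Sum>\<^sub>\<infinity>K\<in>{K. finite K}. ennreal (c\<^sup>2) * ennreal (\<mu> K * (oscillation K f)\<^sup>2))"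
    unfolding hypergraph_energy_def
    using assms
    by (intro infsum_cong)
      (simp add: oscillation_cmult power_mult_distrib mult.left_commute flip: ennreal_mult')
  then show ?thesis
    by (simp add: infsum_cmult_ennreal hypergraph_energy_def)
qed

lemma convex_hypergraph_energy:
  assumes \<mu>: "\<And>K. finite K \<Longrightarrow> 0 \<le> \<mu> K"
  shows "convex_functional (hypergraph_energy \<mu>)"
  unfolding convex_functional_def
proof (intro allI ballI)
  fix f g :: "'a \<Rightarrow> real" and t :: real assume t: "t \<in> {0..1}"
  have "hypergraph_energy \<mu> (\<lambda>x. t * f x + (1 - t) * g x)
    \<le> (\<Sum>\<^sub>\<infinity>K\<in>{K. finite K}. ennreal t * ennreal (\<mu> K * (oscillation K f)\<^sup>2)
          + ennreal (1 - t) * ennreal (\<mu> K * (oscillation K g)\<^sup>2))"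
    unfolding hypergraph_energy_def
  proof (intro infsum_mono)
    fix K :: "'a set" assume "K \<in> {K. finite K}"
    then have K: "finite K"
      by simp
    have "\<mu> K * (oscillation K (\<lambda>x. t * f x + (1 - t) * g x))\<^sup>2
        \<le> \<mu> K * (t * (oscillation K f)\<^sup>2 + (1 - t) * (oscillation K g)\<^sup>2)"
      using K t \<mu> by (intro mult_left_mono oscillation_square_convex) auto
    also have "\<dots> = t * (\<mu> K * (oscillation K f)\<^sup>2) + (1 - t) * (\<mu> K * (oscillation K g)\<^sup>2)"
      by (simp add: algebra_simps)
    finally show "ennreal (\<mu> K * (oscillation K (\<lambda>x. t * f x + (1 - t) * g x))\<^sup>2)
        \<le> ennreal t * ennreal (\<mu> K * (oscillation K f)\<^sup>2)
          + ennreal (1 - t) * ennreal (\<mu> K * (oscillation K g)\<^sup>2)"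
      using t \<mu>[OF K] by (simp add: ennreal_leI flip: ennreal_mult ennreal_plus)
  qed (simp_all add: nonneg_summable_on_complete)
  then show "hypergraph_energy \<mu> (\<lambda>x. t * f x + (1 - t) * g x)
      \<le> ennreal t * hypergraph_energy \<mu> f + ennreal (1 - t) * hypergraph_energy \<mu> g"
    by (simp add: infsum_add nonneg_summable_on_complete infsum_cmult_ennreal hypergraph_energy_def)
qed

text \<open>Each summand is continuous for pointwise convergence, so the Fatou inequality
  applies.\<close>

lemma lsc_hypergraph_energy: "lsc_pointwise (hypergraph_energy \<mu>)"
  unfolding lsc_pointwise_def hypergraph_energy_def[abs_def]
  by (auto intro!: infsum_le_Liminf_ennreal tendsto_ennrealI tendsto_mult tendsto_power
      tendsto_oscillation)

lemma normal_contractions_hypergraph_energy: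
  assumes \<mu>: "\<And>K. finite K \<Longrightarrow> 0 \<le> \<mu> K"
  shows "normal_contractions_operate (hypergraph_energy \<mu>)"
  unfolding normal_contractions_operate_def
proof (intro allI impI)
  fix C :: "real \<Rightarrow> real" and f g :: "'a \<Rightarrow> real"
  assume "1-lipschitz_on UNIV C \<and> C 0 = 0"
  then have C: "\<bar>C s - C t\<bar> \<le> \<bar>s - t\<bar>" for s t
    using lipschitz_onD[of 1 UNIV C s t] by (simp add: dist_real_def)
  have "ennreal (\<mu> K * (oscillation K (\<lambda>x. f x + C (g x)))\<^sup>2)
        + ennreal (\<mu> K * (oscillation K (\<lambda>x. f x - C (g x)))\<^sup>2)
      \<le> ennreal (\<mu> K * (oscillation K (\<lambda>x. f x + g x))\<^sup>2)
        + ennreal (\<mu> K * (oscillation K (\<lambda>x. f x - g x))\<^sup>2)" if K: "finite K" for K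
    using mult_left_mono[OF oscillation_square_contraction[OF K C, of f g] \<mu>[OF K]] \<mu>[OF K]
    by (simp add: distrib_left ennreal_leI flip: ennreal_plus)
  then show "hypergraph_energy \<mu> (\<lambda>x. f x + C (g x)) + hypergraph_energy \<mu> (\<lambda>x. f x - C (g x))
      \<le> hypergraph_energy \<mu> (\<lambda>x. f x + g x) + hypergraph_energy \<mu> (\<lambda>x. f x - g x)"
    unfolding hypergraph_energy_def
    \<comment> \<open>Each side is merged into a single sum over hyperedges, to be compared term by
      term.\<close>
    by (subst (1 2) infsum_add[symmetric]) (auto intro!: infsum_mono nonneg_summable_on_complete)
qed

section \<open>Finite resistance and reachability in the graph\<close>

lemma hypergraph_edge_increment_bound:
  assumes "(x, y) \<in> parcs (hypergraph_graph \<mu>)"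
  obtains c where "\<And>f. hypergraph_energy \<mu> f \<le> 1 \<Longrightarrow> f x - f y \<le> c"
proof -
  obtain K where K: "finite K" "0 < \<mu> K" "x \<in> K" "y \<in> K"
    using assms by (auto simp: hypergraph_graph_def)
  \<comment> \<open>The summand of \<open>K\<close> alone is at most 1, which bounds the oscillation
    on \<open>K\<close> uniformly in \<open>f\<close>.\<close>
  have "f x - f y \<le> sqrt (1 / \<mu> K)" if "hypergraph_energy \<mu> f \<le> 1" for f
  proof -
    have "ennreal (\<mu> K * (oscillation K f)\<^sup>2) \<le> 1"
      using hypergraph_energy_term_le[OF K(1)] that by (rule order_trans)
    then have "(oscillation K f)\<^sup>2 \<le> 1 / \<mu> K"
      using K(2) by (simp add: field_simps)
    then have "oscillation K f \<le> sqrt (1 / \<mu> K)"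
      by (rule real_le_rsqrt)
    with diff_le_oscillation[OF K(1,3,4), of f] show ?thesis
      by simp
  qed
  then show ?thesis
    by (rule that)
qed

text \<open>Edge bounds add up along a path by telescoping. The constant is chosen before
  \<open>f\<close>, as the supremum in the resistance requires.\<close>

lemma hypergraph_path_increment_bound:
  assumes "(x, y) \<in> (parcs (hypergraph_graph \<mu>))\<^sup>*"
  shows "\<exists>c. \<forall>f. hypergraph_energy \<mu> f \<le> 1 \<longrightarrow> f x - f y \<le> c"
  using assms
proof induction
  case base
  then show ?case
    by (intro exI[of _ 0]) simp
next
  case (step y z)
  then obtain c where c: "\<And>f. hypergraph_energy \<mu> f \<le> 1 \<Longrightarrow> f x - f y \<le> c"
    by blast
  obtain d where d: "\<And>f. hypergraph_energy \<mu> f \<le> 1 \<Longrightarrow> f y - f z \<le> d"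
    using hypergraph_edge_increment_bound[OF step(2)] by blast
  have "f x - f z \<le> c + d" if "hypergraph_energy \<mu> f \<le> 1" for f
    using c[OF that] d[OF that] by simp
  then show ?case
    by blast
qed

text \<open>A hyperedge of positive weight that meets the component of \<open>x\<close> lies inside
  it, so the function is constant on it. The free height \<open>t\<close> later makes the resistance
  unbounded.\<close>

lemma hypergraph_energy_component_indicator:
  fixes x :: 'a and t :: real
  assumes \<mu>: "\<And>K. finite K \<Longrightarrow> 0 \<le> \<mu> K"
  shows "hypergraph_energy \<mu>
    (\<lambda>z. if (x, z) \<in> (parcs (hypergraph_graph \<mu>))\<^sup>* then t else 0) = 0"
    (is "hypergraph_energy \<mu> ?f = 0")
  unfolding hypergraph_energy_def
proof (intro infsum_0)
  fix K :: "'a set" assume "K \<in> {K. finite K}"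
  then have K: "finite K"
    by simp
  show "ennreal (\<mu> K * (oscillation K ?f)\<^sup>2) = 0"
  proof (cases "\<mu> K = 0")
    case False
    then have "0 < \<mu> K"
      using \<mu>[OF K] by simp
    then have closed: "(x, w) \<in> (parcs (hypergraph_graph \<mu>))\<^sup>*"
      if "z \<in> K" "w \<in> K" "(x, z) \<in> (parcs (hypergraph_graph \<mu>))\<^sup>*" for z w
      using that K
      \<comment> \<open>Equal points are split off because the graph has no loops.\<close>
      by (cases "z = w") (auto simp: hypergraph_graph_def intro: rtrancl_into_rtrancl)
    have "?f z - ?f w \<le> 0" if "z \<in> K" "w \<in> K" for z w
      using closed[OF that] closed[OF that(2,1)] by (simp split: if_splits)
    with K have "oscillation K ?f \<le> 0"
      by (intro oscillation_le) simp_all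
    then have "oscillation K ?f = 0"
      using oscillation_nonneg[OF K, of ?f] by simp
    then show ?thesis
      by simp
  qed simp
qed

lemma hypergraph_resistance_finite_iff:
  assumes \<mu>: "\<And>K. finite K \<Longrightarrow> 0 \<le> \<mu> K"
  shows "resistance (hypergraph_energy \<mu>) x y < \<infinity> \<longleftrightarrow> (x, y) \<in> (parcs (hypergraph_graph \<mu>))\<^sup>*"
proof
  assume "(x, y) \<in> (parcs (hypergraph_graph \<mu>))\<^sup>*"
  then obtain c where "\<And>f. hypergraph_energy \<mu> f \<le> 1 \<Longrightarrow> f x - f y \<le> c"
    using hypergraph_path_increment_bound[of x y \<mu>] by metis
  then have "resistance (hypergraph_energy \<mu>) x y \<le> ereal c"
    unfolding resistance_def by (intro SUP_least) auto
  then show "resistance (hypergraph_energy \<mu>) x y < \<infinity>"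
    by auto
next
  assume fin: "resistance (hypergraph_energy \<mu>) x y < \<infinity>"
  show "(x, y) \<in> (parcs (hypergraph_graph \<mu>))\<^sup>*"
  proof (rule ccontr)
    assume nc: "(x, y) \<notin> (parcs (hypergraph_graph \<mu>))\<^sup>*"
    have "ereal t \<le> resistance (hypergraph_energy \<mu>) x y" for t
      unfolding resistance_def
      \<comment> \<open>This function is \<open>t\<close> at \<open>x\<close>, \<open>0\<close> at
        \<open>y\<close>, and has energy \<open>0\<close>, so it competes in the supremum for every
        \<open>t\<close>.\<close>
      by (rule SUP_upper2[of "\<lambda>z. if (x, z) \<in> (parcs (hypergraph_graph \<mu>))\<^sup>* then t else 0"])
        (use nc hypergraph_energy_component_indicator[of \<mu> x, OF \<mu>] in simp_all)
    then have "resistance (hypergraph_energy \<mu>) x y = \<infinity>"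
      by (meson ereal_top)
    with fin show False
      by simp
  qed
qed

section \<open>Domain, modular domain and finitely supported functions\<close>

lemma form_domain_eq_modular_domain_hypergraph_energy:
  "form_domain (hypergraph_energy \<mu>) = modular_domain (hypergraph_energy \<mu>)"
proof (intro set_eqI)
  fix f :: "'a \<Rightarrow> real"
  let ?E = "hypergraph_energy \<mu> f"
  have "f \<in> modular_domain (hypergraph_energy \<mu>) \<longleftrightarrow>
      ((\<lambda>\<alpha>. ennreal (\<alpha>\<^sup>2) * ?E) \<longlongrightarrow> 0) (at_right 0)"
    unfolding modular_domain_def mem_Collect_eq
    by (intro tendsto_cong eventually_at_right_less[THEN eventually_mono] hypergraph_energy_cmult)
  also have "\<dots> \<longleftrightarrow> ?E < \<infinity>"
  proof (cases "?E = \<infinity>")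
    case True
    \<comment> \<open>For \<alpha> > 0 the product with infinite energy stays infinite, so its limit
      is \<open>top\<close>, and limits are unique.\<close>
    have "\<forall>\<^sub>F \<alpha> in at_right (0::real). ennreal (\<alpha>\<^sup>2) * ?E = top"
      using eventually_at_right_less by eventually_elim (simp add: True ennreal_mult_top)
    then have "((\<lambda>\<alpha>. ennreal (\<alpha>\<^sup>2) * ?E) \<longlongrightarrow> top) (at_right 0)"
      by (rule tendsto_eventually)
    then have "\<not> ((\<lambda>\<alpha>. ennreal (\<alpha>\<^sup>2) * ?E) \<longlongrightarrow> 0) (at_right 0)"
      using tendsto_unique[OF trivial_limit_at_right_real] ennreal_top_neq_zero by blast
    with True show ?thesis
      by simp
  next
    case False
    then obtain e where e: "?E = ennreal e" "0 \<le> e"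
      by (cases ?E) auto
    have "((\<lambda>\<alpha>. ennreal (\<alpha>\<^sup>2 * e)) \<longlongrightarrow> ennreal (0\<^sup>2 * e)) (at_right 0)"
      by (intro tendsto_intros)
    then have "((\<lambda>\<alpha>. ennreal (\<alpha>\<^sup>2) * ?E) \<longlongrightarrow> 0) (at_right 0)"
      unfolding e(1) by (simp add: ennreal_mult' e(2))
    then show ?thesis
      by (simp add: e(1))
  qed
  finally show "f \<in> form_domain (hypergraph_energy \<mu>) \<longleftrightarrow> f \<in> modular_domain (hypergraph_energy \<mu>)"
    by (simp add: form_domain_def)
qed

text \<open>Only hyperedges meeting the support contribute, and each of them contains some support
  point. The energy is thus at most a constant times the sum, over the finite support, of the
  weights of the hyperedges through each point.\<close>

lemma finitely_supported_subset_form_domain_hypergraph_energy: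
  assumes \<mu>: "\<And>K. finite K \<Longrightarrow> 0 \<le> \<mu> K"
    and fin: "\<And>x. (\<Sum>\<^sub>\<infinity>W\<in>{W. finite W \<and> x \<in> W}. ennreal (\<mu> W)) < \<infinity>"
  shows "finitely_supported \<subseteq> form_domain (hypergraph_energy \<mu>)"
proof
  fix f :: "'a \<Rightarrow> real"
  assume "f \<in> finitely_supported"
  then have S: "finite {x. f x \<noteq> 0}"
    by (simp add: finitely_supported_def)
  let ?S = "{x. f x \<noteq> 0}"
  \<comment> \<open>A crude bound for the absolute value of \<open>f\<close>; as a sum it is also
    defined, and \<open>0\<close>, for empty support.\<close>
  define M where "M = (\<Sum>x\<in>?S. \<bar>f x\<bar>)"
  have M: "\<bar>f x\<bar> \<le> M" for x
    unfolding M_def using S by (cases "f x = 0") (auto intro!: sum_nonneg member_le_sum)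
  \<comment> \<open>Writing membership of \<open>x\<close> as a conditional keeps the outer index
    set independent of \<open>x\<close>, so the two sums can be exchanged.\<close>
  have "hypergraph_energy \<mu> f \<le>
      (\<Sum>\<^sub>\<infinity>K\<in>{K. finite K}. \<Sum>x\<in>?S. ennreal ((2 * M)\<^sup>2) * (if x \<in> K then ennreal (\<mu> K) else 0))"
    unfolding hypergraph_energy_def
  proof (intro infsum_mono)
    fix K :: "'a set" assume "K \<in> {K. finite K}"
    then have K: "finite K"
      by simp
    show "ennreal (\<mu> K * (oscillation K f)\<^sup>2)
        \<le> (\<Sum>x\<in>?S. ennreal ((2 * M)\<^sup>2) * (if x \<in> K then ennreal (\<mu> K) else 0))"
    proof (cases "K \<inter> ?S = {}")
      case True
      then have "f x = 0" if "x \<in> K" for x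
        using that by blast
      with K have "oscillation K f \<le> 0"
        by (intro oscillation_le) auto
      then have "oscillation K f = 0"
        using oscillation_nonneg[OF K, of f] by simp
      then show ?thesis
        by simp
    next
      case False
      then obtain x where x: "x \<in> K" "x \<in> ?S"
        by blast
      have "oscillation K f \<le> 2 * M"
      proof (rule oscillation_le[OF K])
        show "0 \<le> 2 * M"
          using M[of x] by simp
        show "f y - f z \<le> 2 * M" for y z
          using M[of y] M[of z] by linarith
      qed
      then have "(oscillation K f)\<^sup>2 \<le> (2 * M)\<^sup>2"
        using oscillation_nonneg[OF K] by (intro power_mono)
      then have "ennreal (\<mu> K * (oscillation K f)\<^sup>2) \<le> ennreal (\<mu> K * (2 * M)\<^sup>2)"
        using \<mu>[OF K] by (intro ennreal_leI mult_left_mono)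
      also have "\<dots> = ennreal ((2 * M)\<^sup>2) * (if x \<in> K then ennreal (\<mu> K) else 0)"
        using x \<mu>[OF K] by (simp add: ennreal_mult mult.commute)
      also have "\<dots> \<le> (\<Sum>x\<in>?S. ennreal ((2 * M)\<^sup>2) * (if x \<in> K then ennreal (\<mu> K) else 0))"
        using x(2) S by (intro member_le_sum) auto
      finally show ?thesis .
    qed
  qed (simp_all add: nonneg_summable_on_complete)
  also have "\<dots> = (\<Sum>x\<in>?S. ennreal ((2 * M)\<^sup>2) *
      (\<Sum>\<^sub>\<infinity>K\<in>{K. finite K}. if x \<in> K then ennreal (\<mu> K) else 0))"
    using S by (simp add: infsum_sum_ennreal infsum_cmult_ennreal)
  also have "\<dots> = (\<Sum>x\<in>?S. ennreal ((2 * M)\<^sup>2) * (\<Sum>\<^sub>\<infinity>W\<in>{W. finite W \<and> x \<in> W}. ennreal (\<mu> W)))"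
    \<comment> \<open>The finite sets not containing \<open>x\<close> contribute \<open>0\<close>
      and are dropped.\<close>
    by (intro sum.cong arg_cong2[where f = "(*)"] infsum_cong_neutral) auto
  also have "\<dots> < \<infinity>"
    using fin S by (auto simp: ennreal_mult_less_top)
  finally show "f \<in> form_domain (hypergraph_energy \<mu>)"
    by (simp add: form_domain_def)
qed

theorem proposition5p5:
  fixes \<mu> :: "'a::countable set \<Rightarrow> real"
  assumes \<mu>_nonneg: "\<And>K. finite K \<Longrightarrow> 0 \<le> \<mu> K"
  shows "(nonlinear_resistance_form (hypergraph_energy \<mu>) \<longleftrightarrow>
            Digraph_Component.connected (with_proj (hypergraph_graph \<mu>))) \<and>
         ((\<forall>x. (\<Sum>\<^sub>\<infinity>W\<in>{W. finite W \<and> x \<in> W}. ennreal (\<mu> W)) < \<infinity>) \<longrightarrow>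
            finitely_supported \<subseteq> form_domain (hypergraph_energy \<mu>) \<and>
            form_domain (hypergraph_energy \<mu>) = modular_domain (hypergraph_energy \<mu>))"
proof (intro conjI impI)
  have "resistance (hypergraph_energy \<mu>) x y < \<infinity> \<longleftrightarrow> (x, y) \<in> (parcs (hypergraph_graph \<mu>))\<^sup>*" for x y
    using \<mu>_nonneg by (rule hypergraph_resistance_finite_iff)
  moreover have "convex_functional (hypergraph_energy \<mu>)"
    using \<mu>_nonneg by (rule convex_hypergraph_energy)
  moreover have "normal_contractions_operate (hypergraph_energy \<mu>)"
    using \<mu>_nonneg by (rule normal_contractions_hypergraph_energy)
  ultimately show "nonlinear_resistance_form (hypergraph_energy \<mu>) \<longleftrightarrow>
      Digraph_Component.connected (with_proj (hypergraph_graph \<mu>))"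
    \<comment> \<open>All other axioms hold outright, so what remains is finite resistance for all
      pairs, which is reachability for all pairs.\<close>
    unfolding nonlinear_resistance_form_def connected_hypergraph_graph_iff
    by (simp only: hypergraph_energy_zero lsc_hypergraph_energy simp_thms)
next
  assume "\<forall>x. (\<Sum>\<^sub>\<infinity>W\<in>{W. finite W \<and> x \<in> W}. ennreal (\<mu> W)) < \<infinity>"
  then show "finitely_supported \<subseteq> form_domain (hypergraph_energy \<mu>)"
    using finitely_supported_subset_form_domain_hypergraph_energy[of \<mu>, OF \<mu>_nonneg] by blast
qed (rule form_domain_eq_modular_domain_hypergraph_energy)

end
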